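(* Let $m\ge1$. Identify $\mathcal A(\mathbf B^m)$ with the set of antichains $A\in\mathcal A(\mathbf A^{2m-1})$ that are invariant under the reflection $[i,j]\mapsto[2m-j,2m-i]$. Then \[|\{A\in\mathcal A(\mathbf B^m):\mathrm{LK}_{\mathcal A}(\rho_{\mathcal A}(A))=A\}|=2^m,\] where $\mathrm{LK}_{\mathcal A}$ and $\rho_{\mathcal A}$ are the corresponding maps on $\mathcal A(\mathbf A^{2m-1})$.
   Context: $\mathbf A^{n-1}$ is the poset of intervals $\{[i,j]:1\le i\le j\le n-1\}$ ordered by inclusion (type $A$ positive root poset); here $n=2m$. $\mathbf B^m$ is the poset of intervals $\{[i,j]:1\le i\le j\le 2m-1,\ i+j\le 2m\}$ ordered by inclusion (type $B$ positive root poset). $\mathcal A(\cdot)$ denotes the set of antichains. The identification of $\mathcal A(\mathbf B^m)$ with reflection-invariant antichains of $\mathbf A^{2m-1}$ is $A\mapsto\hat A=\{[i,j]:[i,j]\in A\text{ or }[2m-j,2m-i]\in A\}$. Antichain rowmotion $\rho_{\mathcal A}:\mathcal A(\mathbf A^{n-1})\to\mathcal A(\mathbf A^{n-1})$ sends an antichain $A$ to the set of minimal elements of the complement of the order ideal generated by $A$. $\mathrm{LK}_{\mathcal A}:\mathcal A(\mathbf A^{n-1})\to\mathcal A(\mathbf A^{n-1})$ (the Lalanne--Kreweras involution on antichains, due in this form to Panyushev) sends $\{[i_1,j_1],\dots,[i_k,j_k]\}$ to $\{[i'_1,j'_1],\dots,[i'_{n-k-1},j'_{n-k-1}]\}$,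 where $i'_1<\dots<i'_{n-k-1}$ are the elements of $\{1,\dots,n-1\}\setminus\{j_1,\dots,j_k\}$ and $j'_1<\dots<j'_{n-k-1}$ are the elements of $\{1,\dots,n-1\}\setminus\{i_1,\dots,i_k\}$. *)

theory Defs
  imports Main
begin

text \<open>
  The pair \<open>(i, j)\<close> with \<open>i \<le> j\<close> encodes the interval \<open>[i, j]\<close>; the order on pairs
  used throughout is inclusion of intervals, not the product order.
\<close>

type_synonym interval = "nat \<times> nat"

definition incl :: "interval \<Rightarrow> interval \<Rightarrow> bool" where
  "incl p q \<longleftrightarrow> {fst p..snd p} \<subseteq> {fst q..snd q}"

definition rootA :: "nat \<Rightarrow> interval set" where
  "rootA N = {(i, j). 1 \<le> i \<and> i \<le> j \<and> j \<le> N}"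

definition rootB :: "nat \<Rightarrow> interval set" where
  "rootB m = {(i, j). 1 \<le> i \<and> i \<le> j \<and> j \<le> 2 * m - 1 \<and> i + j \<le> 2 * m}"

definition antichains :: "interval set \<Rightarrow> interval set set" where
  "antichains P = {A. A \<subseteq> P \<and> (\<forall>p\<in>A. \<forall>q\<in>A. incl p q \<longrightarrow> p = q)}"

definition order_ideal :: "interval set \<Rightarrow> interval set \<Rightarrow> interval set" where
  "order_ideal P A = {p \<in> P. \<exists>q\<in>A. incl p q}"

definition minimals :: "interval set \<Rightarrow> interval set" where
  "minimals S = {p \<in> S. \<forall>q\<in>S. incl q p \<longrightarrow> q = p}"

definition rowmotion :: "nat \<Rightarrow> interval set \<Rightarrow> interval set" where
  "rowmotion N A = minimals (rootA N - order_ideal (rootA N) A)"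

text \<open>
  Zipping the increasing enumerations of the two complements pairs the \<open>r\<close>-th element of
  the first with the \<open>r\<close>-th element of the second. Distinct elements of an antichain have
  distinct left endpoints and distinct right endpoints, so on antichains the two lists have
  equal length and \<open>zip\<close> does not truncate. Here \<open>N\<close> is \<open>n - 1\<close>.
\<close>

definition LK :: "nat \<Rightarrow> interval set \<Rightarrow> interval set" where
  "LK N A = set (zip (sorted_list_of_set ({1..N} - snd ` A))
                     (sorted_list_of_set ({1..N} - fst ` A)))"

definition reflect :: "nat \<Rightarrow> interval \<Rightarrow> interval" where
  "reflect m p = (2 * m - snd p, 2 * m - fst p)"

definition hat :: "nat \<Rightarrow> interval set \<Rightarrow> interval set" where
  "hat m A = {p \<in> rootA (2 * m - 1). p \<in> A \<or> reflect m p \<in> A}"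

lemma bij_betw_hat:
  "bij_betw (hat m) (antichains (rootB m))
     {A \<in> antichains (rootA (2 * m - 1)). reflect m ` A = A}"
proof (rule bij_betw_byWitness[where f' = "\<lambda>A. A \<inter> rootB m"])
  have rr: "reflect m (reflect m p) = p" "reflect m p \<in> rootA (2 * m - 1)"
    if "p \<in> rootA (2 * m - 1)" for p
    using that by (auto simp: reflect_def rootA_def)
  have BA: "rootB m \<subseteq> rootA (2 * m - 1)"
    by (auto simp: rootA_def rootB_def)
  have fixB: "reflect m p = p" if "p \<in> rootB m" "reflect m p \<in> rootB m" for p
    using that by (auto simp: reflect_def rootB_def)
  have either: "p \<in> rootB m \<or> reflect m p \<in> rootB m" if "p \<in> rootA (2 * m - 1)" for p
    using that by (auto simp: reflect_def rootA_def rootB_def)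
  have mono: "incl (reflect m p) (reflect m q) \<longleftrightarrow> incl p q"
    if "p \<in> rootA (2 * m - 1)" "q \<in> rootA (2 * m - 1)" for p q
    using that by (auto simp: reflect_def rootA_def incl_def)
  have cross: "incl p q \<or> incl q p"
    if "p \<in> rootB m" "q \<in> rootB m" "incl p (reflect m q) \<or> incl (reflect m q) p" for p q
    using that by (auto simp: reflect_def rootB_def incl_def)
  have cross_self: "reflect m p = p"
    if "p \<in> rootB m" "incl p (reflect m p) \<or> incl (reflect m p) p" for p
    using that by (auto simp: reflect_def rootB_def incl_def)
  show "\<forall>A\<in>antichains (rootB m). hat m A \<inter> rootB m = A"
  proof
    fix A assume "A \<in> antichains (rootB m)"
    then have "A \<subseteq> rootB m" by (auto simp: antichains_def)
    then show "hat m A \<inter> rootB m = A"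
      using BA fixB unfolding hat_def by fastforce
  qed
  show "\<forall>A\<in>{A \<in> antichains (rootA (2 * m - 1)). reflect m ` A = A}. hat m (A \<inter> rootB m) = A"
  proof
    fix A assume "A \<in> {A \<in> antichains (rootA (2 * m - 1)). reflect m ` A = A}"
    then have sub: "A \<subseteq> rootA (2 * m - 1)" and "reflect m ` A = A"
      by (simp_all add: antichains_def)
    then have inv: "reflect m p \<in> A" if "p \<in> A" for p using that by blast
    show "hat m (A \<inter> rootB m) = A"
    proof (intro equalityI subsetI)
      fix p assume "p \<in> hat m (A \<inter> rootB m)"
      then have "p \<in> rootA (2 * m - 1)" "p \<in> A \<or> reflect m p \<in> A" by (auto simp: hat_def)
      then show "p \<in> A" using inv[of "reflect m p"] rr(1)[of p] by auto
    next
      fix p assume "p \<in> A"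
      then show "p \<in> hat m (A \<inter> rootB m)" using either[of p] inv[of p] sub by (auto simp: hat_def)
    qed
  qed
  show "(\<lambda>A. A \<inter> rootB m) ` {A \<in> antichains (rootA (2 * m - 1)). reflect m ` A = A}
      \<subseteq> antichains (rootB m)"
    by (auto simp: antichains_def)
  show "hat m ` antichains (rootB m)
      \<subseteq> {A \<in> antichains (rootA (2 * m - 1)). reflect m ` A = A}"
  proof
    fix X assume "X \<in> hat m ` antichains (rootB m)"
    then obtain A where A: "A \<in> antichains (rootB m)" and X: "X = hat m A" by blast
    from A have sub: "A \<subseteq> rootB m" and anti: "\<And>p q. p \<in> A \<Longrightarrow> q \<in> A \<Longrightarrow> incl p q \<Longrightarrow> p = q"
      by (auto simp: antichains_def)
    have XA: "X \<subseteq> rootA (2 * m - 1)" by (auto simp: X hat_def)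
    have cl: "reflect m p \<in> X" if "p \<in> X" for p
      using that rr[of p] by (auto simp: X hat_def)
    have inv: "reflect m ` X = X"
    proof (intro equalityI subsetI)
      fix p assume p: "p \<in> X"
      then have "p = reflect m (reflect m p)" using rr(1)[of p] XA by auto
      then show "p \<in> reflect m ` X" using cl[OF p] by (rule image_eqI)
    qed (use cl in auto)
    have key: "p = q" if p: "p \<in> A" and q: "q \<in> X" and pq: "incl p q \<or> incl q p" for p q
    proof (cases "q \<in> A")
      case True
      with p pq anti show ?thesis by metis
    next
      case False
      with q have r: "reflect m q \<in> A" and qA: "q \<in> rootA (2 * m - 1)" by (auto simp: X hat_def)
      have q': "q = reflect m (reflect m q)" using rr qA by simp
      then have i: "incl p (reflect m (reflect m q)) \<or> incl (reflect m (reflect m q)) p"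
        using pq by simp
      then have "incl p (reflect m q) \<or> incl (reflect m q) p" using cross p r sub by blast
      then have e: "p = reflect m q" using anti p r by metis
      then have "reflect m p = p" using cross_self i p sub by blast
      then show ?thesis using e q' by simp
    qed
    have "p = q" if "p \<in> X" "q \<in> X" "incl p q" for p q
    proof (cases "p \<in> A")
      case True with key that show ?thesis by blast
    next
      case False
      with that have "reflect m p \<in> A" by (auto simp: X hat_def)
      moreover have "incl (reflect m p) (reflect m q)" using mono that XA by blast
      ultimately have "reflect m p = reflect m q" using key cl that by blast
      then show ?thesis using rr(1) that XA by (metis subsetD)
    qed
    with XA inv show "X \<in> {A \<in> antichains (rootA (2 * m - 1)). reflect m ` A = A}"
      by (auto simp: antichains_def)
  qed
qed

end

theory Submission
  imports Defs
begin

text \<open>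
  Let \<open>I\<close> and \<open>J\<close> be the sets of left and right endpoints of an antichain \<open>A\<close>; they determine
  \<open>A\<close>. Call \<open>x\<close> covered if it lies in an interval of \<open>A\<close>. Rowmotion has left endpoints \<open>x\<close> with
  \<open>x\<close> uncovered or \<open>x + 1 \<in> I\<close>, and right endpoints \<open>x\<close> with \<open>x\<close> uncovered or \<open>x - 1 \<in> J\<close>. Hence
  \<open>A\<close> is fixed by rowmotion followed by LK iff, for every \<open>x\<close>, membership in \<open>J\<close> means that \<open>x\<close> is
  covered and \<open>x + 1 \<notin> I\<close>, and membership in \<open>I\<close> means that \<open>x\<close> is covered and \<open>x - 1 \<notin> J\<close>.
  Equivalently, the number of intervals of \<open>A\<close> containing \<open>x\<close>, as a function of \<open>x\<close> from \<open>0\<close> to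
  \<open>n\<close>, is a nonnegative lattice path with steps \<open>+1\<close> and \<open>-1\<close>, and flat steps at height \<open>0\<close> only.
  A reflection-invariant path of length \<open>2m\<close> is determined by its first half, which is arbitrary:
  at each of its \<open>m\<close> steps one chooses whether to go up, the alternative being a flat step at
  height \<open>0\<close> and a down step elsewhere.
\<close>

section \<open>Antichains and their sets of endpoints\<close>

lemma incl_iff: "fst p \<le> snd p \<Longrightarrow> incl p q \<longleftrightarrow> fst q \<le> fst p \<and> snd p \<le> snd q"
  by (simp add: incl_def)

lemma rootA_iff: "p \<in> rootA N \<longleftrightarrow> 1 \<le> fst p \<and> fst p \<le> snd p \<and> snd p \<le> N"
  by (auto simp: rootA_def)

lemma antichainsA_iff:
  "A \<in> antichains (rootA N) \<longleftrightarrow> A \<subseteq> rootA N \<and>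
     (\<forall>p\<in>A. \<forall>q\<in>A. fst q \<le> fst p \<longrightarrow> snd p \<le> snd q \<longrightarrow> p = q)"
  unfolding antichains_def by (fastforce simp: incl_iff rootA_iff)

text \<open>If the two orders disagreed, one of the intervals would contain the other.\<close>

lemma antichain_less_iff:
  assumes "A \<in> antichains (rootA N)" "p \<in> A" "q \<in> A"
  shows "fst p < fst q \<longleftrightarrow> snd p < snd q"
  using assms unfolding antichainsA_iff by (metis leI less_imp_le_nat order.asym)

lemma finite_antichain:
  assumes "A \<in> antichains (rootA N)"
  shows "finite A"
proof -
  have "A \<subseteq> {1..N} \<times> {1..N}"
    using assms by (fastforce simp: antichainsA_iff rootA_iff)
  then show ?thesis by (rule finite_subset) simp
qed

lemma endpoints_subset:
  assumes "A \<in> antichains (rootA N)"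
  shows "fst ` A \<subseteq> {1..N}" "snd ` A \<subseteq> {1..N}"
  using assms by (fastforce simp: antichainsA_iff rootA_iff)+

lemma inj_on_endpoints:
  assumes "A \<in> antichains (rootA N)"
  shows "inj_on fst A" "inj_on snd A"
  using antichain_less_iff[OF assms] unfolding inj_on_def
  by (metis linorder_neq_iff prod.expand, metis linorder_neq_iff prod.expand)

text \<open>By \<open>antichain_less_iff\<close> the right endpoint is a strictly increasing
  function \<open>f\<close> of the left one, so sorting both endpoint sets pairs each left endpoint
  with its own right endpoint.\<close>

lemma antichain_eq_zip:
  assumes A: "A \<in> antichains (rootA N)"
  shows "A = set (zip (sorted_list_of_set (fst ` A)) (sorted_list_of_set (snd ` A)))"
proof -
  define f where "f = snd \<circ> the_inv_into A fst"
  define xs where "xs = sorted_list_of_set (fst ` A)"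
  have f: "f (fst p) = snd p" if "p \<in> A" for p
    using that inj_on_endpoints(1)[OF A] by (simp add: f_def the_inv_into_f_f)
  have set_xs: "set xs = fst ` A"
    by (simp add: xs_def finite_antichain[OF A])
  have "sorted_wrt (<) xs" by (simp add: xs_def)
  moreover have "f x < f y" if "x \<in> set xs" "y \<in> set xs" "x < y" for x y
    using that antichain_less_iff[OF A] f unfolding set_xs by auto
  ultimately have "sorted_wrt (<) (map f xs)"
    by (auto simp: sorted_wrt_map intro: sorted_wrt_mono_rel)
  moreover have "set (map f xs) = snd ` A"
    by (auto simp: set_xs f image_image cong: image_cong)
  ultimately have "sorted_list_of_set (snd ` A) = map f xs"
    by (metis sorted_list_of_set.idem_if_sorted_distinct strict_sorted_iff)
  then have "set (zip (sorted_list_of_set (fst ` A)) (sorted_list_of_set (snd ` A)))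
      = (\<lambda>x. (x, f x)) ` fst ` A"
    unfolding xs_def[symmetric] by (auto simp: zip_map2 zip_same_conv_map set_xs[symmetric])
  also have "\<dots> = A"
    by (force simp: image_image f)
  finally show ?thesis by simp
qed

lemma antichain_eqI:
  assumes "A \<in> antichains (rootA N)" "B \<in> antichains (rootA N)"
    and "fst ` A = fst ` B" "snd ` A = snd ` B"
  shows "A = B"
  using antichain_eq_zip[OF assms(1)] antichain_eq_zip[OF assms(2)] assms(3,4) by metis

lemma image_set_zip:
  assumes "length xs = length ys"
  shows "fst ` set (zip xs ys) = set xs" "snd ` set (zip xs ys) = set ys"
  using assms by (metis map_fst_zip set_map, metis map_snd_zip set_map)

text \<open>The witness zips the sorted enumerations. The ballot condition makes each pair an
  interval; strict increase in both coordinates rules out containment between two of them.\<close>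

lemma antichain_exists:
  assumes I: "I \<subseteq> {1..N}" and J: "J \<subseteq> {1..N}" and card: "card I = card J"
    and ballot: "\<And>x. card (J \<inter> {..x}) \<le> card (I \<inter> {..x})"
  obtains A where "A \<in> antichains (rootA N)" "fst ` A = I" "snd ` A = J"
proof
  define xs where "xs = sorted_list_of_set I"
  define ys where "ys = sorted_list_of_set J"
  define A where "A = set (zip xs ys)"
  have fin: "finite I" "finite J" using I J finite_subset by blast+
  have len: "length xs = card I" "length ys = card I"
    by (simp_all add: xs_def ys_def card)
  have set: "set xs = I" "set ys = J" by (simp_all add: xs_def ys_def fin)
  have s: "sorted_wrt (<) xs" "sorted_wrt (<) ys" by (simp_all add: xs_def ys_def)
  have xs_less: "xs ! r < xs ! t" and ys_less: "ys ! r < ys ! t" if "r < t" "t < card I" for r t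
    using that s len by (simp_all add: sorted_wrt_nth_less)
  \<comment> \<open>If \<open>xs ! t > ys ! t\<close>, the ballot condition fails at \<open>ys ! t\<close>.\<close>
  have le: "xs ! t \<le> ys ! t" if t: "t < card I" for t
  proof (rule ccontr)
    assume "\<not> xs ! t \<le> ys ! t"
    then have less: "ys ! t < xs ! t" by simp
    have "I \<inter> {..ys ! t} \<subseteq> (!) xs ` {..<t}"
    proof
      fix i assume i: "i \<in> I \<inter> {..ys ! t}"
      then obtain r where r: "i = xs ! r" "r < card I"
        using set len by (metis IntD1 in_set_conv_nth)
      then have "r < t"
        using i less xs_less[of t r] by (cases r t rule: linorder_cases) auto
      then show "i \<in> (!) xs ` {..<t}" using r by blast
    qed
    then have "card (I \<inter> {..ys ! t}) \<le> t"
      by (metis card_image_le card_lessThan card_mono finite_imageI finite_lessThan order_trans)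
    moreover have "(!) ys ` {..t} \<subseteq> J \<inter> {..ys ! t}"
      using t ys_less len set by (force simp: le_less)
    then have "card ((!) ys ` {..t}) \<le> card (J \<inter> {..ys ! t})"
      using fin by (simp add: card_mono)
    moreover have "inj_on ((!) ys) {..t}"
      using ys_less t by (intro linorder_inj_onI) (auto dest: le_less_trans simp: nat_neq_iff)
    ultimately show False using ballot[of "ys ! t"] by (simp add: card_image)
  qed
  have A: "A = {(xs ! t, ys ! t) | t. t < card I}"
    by (simp add: A_def set_zip len)
  show fst: "fst ` A = I" and snd: "snd ` A = J"
    using len set by (simp_all add: A_def image_set_zip)
  have "A \<subseteq> rootA N"
  proof
    fix p assume p: "p \<in> A"
    then have "fst p \<in> I" "snd p \<in> J" using fst snd by blast+
    moreover have "fst p \<le> snd p" using p le by (auto simp: A)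
    ultimately show "p \<in> rootA N" using I J by (auto simp: rootA_iff)
  qed
  moreover have "p = q" if mem: "p \<in> A" "q \<in> A" and pq: "fst q \<le> fst p" "snd p \<le> snd q" for p q
  proof -
    obtain r t where rt: "p = (xs ! r, ys ! r)" "r < card I" "q = (xs ! t, ys ! t)" "t < card I"
      using mem unfolding A by blast
    then have "r = t"
      using pq xs_less[of r t] ys_less[of t r] by (cases r t rule: linorder_cases) auto
    then show ?thesis using rt by simp
  qed
  ultimately show "A \<in> antichains (rootA N)" by (simp add: antichainsA_iff)
qed

section \<open>Fixed points of the composition of LK with rowmotion\<close>

definition depth :: "interval set \<Rightarrow> nat \<Rightarrow> nat" where
  "depth A x = card {p \<in> A. fst p \<le> x \<and> x \<le> snd p}"

lemma depth_pos_iff: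
  assumes "A \<in> antichains (rootA N)"
  shows "0 < depth A x \<longleftrightarrow> (\<exists>p\<in>A. fst p \<le> x \<and> x \<le> snd p)"
proof -
  have "finite {p \<in> A. fst p \<le> x \<and> x \<le> snd p}"
    using finite_antichain[OF assms] by simp
  then show ?thesis unfolding depth_def card_gt_0_iff by blast
qed

lemma depth_0:
  assumes "A \<in> antichains (rootA N)"
  shows "depth A 0 = 0"
proof -
  have "1 \<le> fst p" if "p \<in> A" for p
    using endpoints_subset(1)[OF assms] that by auto
  then have "{p \<in> A. fst p \<le> 0 \<and> 0 \<le> snd p} = {}" by fastforce
  then show ?thesis unfolding depth_def by (simp only: card.empty)
qed

lemma card_inj_fibre:
  assumes "inj_on f A"
  shows "card {p \<in> A. f p = x} = of_bool (x \<in> f ` A)"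
proof (cases "x \<in> f ` A")
  case True
  then obtain p where "p \<in> A" "f p = x" by blast
  with assms have "{p \<in> A. f p = x} = {p}" by (auto simp: inj_on_def)
  then show ?thesis using True by simp
next
  case False
  then have "{p \<in> A. f p = x} = {}" by blast
  then have "card {p \<in> A. f p = x} = 0" by (simp only: card.empty)
  then show ?thesis using False by (simp only: of_bool_eq)
qed

lemma depth_Suc:
  assumes A: "A \<in> antichains (rootA N)"
  shows "depth A (Suc x) + of_bool (x \<in> snd ` A) = depth A x + of_bool (Suc x \<in> fst ` A)"
proof -
  have fin: "finite A" using finite_antichain[OF A] .
  have le: "fst p \<le> snd p" if "p \<in> A" for p
    using A that by (auto simp: antichainsA_iff rootA_iff)
  \<comment> \<open>Both sides of the identity count the intervals of \<open>A\<close> that meet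
    \<open>{x, Suc x}\<close>.\<close>
  have "depth A (Suc x) + card {p \<in> A. snd p = x}
      = card ({p \<in> A. fst p \<le> Suc x \<and> Suc x \<le> snd p} \<union> {p \<in> A. snd p = x})"
    unfolding depth_def using fin by (subst card_Un_disjoint) auto
  also have "\<dots> = card ({p \<in> A. fst p \<le> x \<and> x \<le> snd p} \<union> {p \<in> A. fst p = Suc x})"
    by (rule arg_cong[where f = card]) (auto dest: le)
  also have "\<dots> = depth A x + card {p \<in> A. fst p = Suc x}"
    unfolding depth_def using fin by (subst card_Un_disjoint) auto
  finally show ?thesis
    using inj_on_endpoints[OF A] by (simp add: card_inj_fibre)
qed

section \<open>Endpoints of the rowmotion image\<close>

definition outside :: "nat \<Rightarrow> interval set \<Rightarrow> nat \<Rightarrow> nat \<Rightarrow> bool" where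
  "outside N A a b \<longleftrightarrow>
    1 \<le> a \<and> a \<le> b \<and> b \<le> N \<and> (\<forall>p\<in>A. \<not> (fst p \<le> a \<and> b \<le> snd p))"

text \<open>The complement of the order ideal is upward closed, so minimality need only be tested
  after shortening an interval by one at either end. For \<open>a = b\<close> the shortened pairs
  are no intervals and fail \<open>outside\<close>.\<close>

lemma rowmotion_iff:
  assumes A: "A \<in> antichains (rootA N)"
  shows "(a, b) \<in> rowmotion N A \<longleftrightarrow>
    outside N A a b \<and> \<not> outside N A (Suc a) b \<and> \<not> outside N A a (b - 1)"
proof -
  let ?U = "outside N A"
  have mem: "p \<in> rootA N - order_ideal (rootA N) A \<longleftrightarrow> ?U (fst p) (snd p)" for p
    by (auto simp: outside_def order_ideal_def rootA_iff incl_iff)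
  have up: "?U a' b'" if "?U a b" "1 \<le> a'" "a' \<le> a" "b \<le> b'" "b' \<le> N" for a b a' b'
    using that unfolding outside_def by (meson order_trans)
  have U_le: "a \<le> b" "1 \<le> a" "b \<le> N" if "?U a b" for a b using that by (simp_all add: outside_def)
  show ?thesis
  proof
    assume "(a, b) \<in> rowmotion N A"
    then have ab: "?U a b" and min: "\<And>c d. ?U c d \<Longrightarrow> incl (c, d) (a, b) \<Longrightarrow> (c, d) = (a, b)"
      unfolding rowmotion_def minimals_def using mem by force+
    have "\<not> ?U (Suc a) b" using min[of "Suc a" b] U_le[of "Suc a" b] by (auto simp: incl_iff)
    moreover have "\<not> ?U a (b - 1)"
      using min[of a "b - 1"] U_le[of a "b - 1"] by (auto simp: incl_iff)
    ultimately show "?U a b \<and> \<not> ?U (Suc a) b \<and> \<not> ?U a (b - 1)" using ab by blast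
  next
    assume r: "?U a b \<and> \<not> ?U (Suc a) b \<and> \<not> ?U a (b - 1)"
    have min: "(c, d) = (a, b)" if cd: "?U c d" "incl (c, d) (a, b)" for c d
    proof -
      have i: "a \<le> c" "d \<le> b" using cd U_le[of c d] by (auto simp: incl_iff)
      have "\<not> a < c"
        using up[of c d "Suc a" b] i(2) r cd(1) U_le(3)[of a b] by (auto simp: Suc_le_eq)
      moreover have "\<not> d < b"
      proof
        assume "d < b"
        then have "?U a (b - 1)" using up[OF cd(1)] i(1) U_le(2,3)[of a b] r by simp
        then show False using r by blast
      qed
      ultimately show ?thesis using i by auto
    qed
    have "q = (a, b)" if "q \<in> rootA N - order_ideal (rootA N) A" "incl q (a, b)" for q
      using min[of "fst q" "snd q"] that mem[of q] by simp
    moreover have "(a, b) \<in> rootA N - order_ideal (rootA N) A"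
      using r mem[of "(a, b)"] by simp
    ultimately show "(a, b) \<in> rowmotion N A"
      unfolding rowmotion_def minimals_def by blast
  qed
qed

text \<open>An uncovered \<open>x\<close> gives the minimal element \<open>[x, x]\<close>. For
  covered \<open>x\<close>, minimality of \<open>[x, b]\<close> yields an interval of
  \<open>A\<close> that contains \<open>[x + 1, b]\<close> but not \<open>[x, b]\<close>, hence
  starts at \<open>x + 1\<close>.\<close>

lemma fst_rowmotion:
  assumes A: "A \<in> antichains (rootA N)"
  shows "fst ` rowmotion N A = {x \<in> {1..N}. depth A x = 0 \<or> Suc x \<in> fst ` A}"
proof -
  let ?U = "outside N A"
  note rho = rowmotion_iff[OF A]
  have U_diag: "?U x x \<longleftrightarrow> x \<in> {1..N} \<and> depth A x = 0" for x
    using depth_pos_iff[OF A, of x] by (auto simp: outside_def)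
  show ?thesis
  proof (intro equalityI subsetI)
    fix x assume "x \<in> fst ` rowmotion N A"
    then obtain b where b: "?U x b" "\<not> ?U (Suc x) b" "\<not> ?U x (b - 1)" using rho by auto
    then have x: "x \<in> {1..N}" by (auto simp: outside_def)
    have "Suc x \<in> fst ` A" if d: "depth A x \<noteq> 0"
    proof -
      have "x \<noteq> b" using U_diag[of x] b(1) d by auto
      then obtain p where "p \<in> A" "fst p \<le> Suc x" "b \<le> snd p"
        using b(1,2) unfolding outside_def by fastforce
      moreover from this have "\<not> fst p \<le> x" using b(1) by (auto simp: outside_def)
      ultimately show ?thesis by (metis image_eqI le_SucE)
    qed
    then show "x \<in> {x \<in> {1..N}. depth A x = 0 \<or> Suc x \<in> fst ` A}" using x by blast
  next
    fix x assume x: "x \<in> {x \<in> {1..N}. depth A x = 0 \<or> Suc x \<in> fst ` A}"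
    show "x \<in> fst ` rowmotion N A"
    proof (cases "depth A x = 0")
      case True
      then have "(x, x) \<in> rowmotion N A"
        using x U_diag[of x] unfolding rho by (auto simp: outside_def)
      then show ?thesis by force
    next
      case False
      then obtain p where p: "p \<in> A" "fst p = Suc x" using x by auto
      have pN: "fst p \<le> snd p" "snd p \<le> N" using A p by (auto simp: antichainsA_iff rootA_iff)
      \<comment> \<open>An interval of \<open>A\<close> containing \<open>[x, snd p]\<close> would
        properly contain \<open>p\<close>.\<close>
      have Up: "?U x (snd p)"
      proof -
        have "\<not> (fst q \<le> x \<and> snd p \<le> snd q)" if "q \<in> A" for q
          using A p that unfolding antichainsA_iff by (metis Suc_n_not_le_n le_SucI)
        then show ?thesis using pN p x by (auto simp: outside_def)
      qed
      \<comment> \<open>Leastness excludes \<open>[x, b - 1]\<close>, and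
        \<open>b \<le> snd p\<close> lets \<open>p\<close> exclude
        \<open>[Suc x, b]\<close>.\<close>
      define b where "b = (LEAST b. ?U x b)"
      have b: "?U x b" "b \<le> snd p" unfolding b_def using Up by (auto intro: LeastI Least_le)
      have "b \<noteq> 0" using b(1) by (auto simp: outside_def)
      then have "\<not> ?U x (b - 1)" unfolding b_def by (intro not_less_Least) simp
      moreover have "\<not> ?U (Suc x) b" using p b(2) unfolding outside_def by (metis order_refl)
      ultimately show ?thesis using b(1) rho by force
    qed
  qed
qed

text \<open>Mirror image of \<open>fst_rowmotion\<close>, with a greatest left endpoint in place of
  the least right one. For \<open>x = 1\<close> the index \<open>x - 1\<close> is \<open>0\<close>,
  which is no right endpoint.\<close>

lemma snd_rowmotion:
  assumes A: "A \<in> antichains (rootA N)"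
  shows "snd ` rowmotion N A = {x \<in> {1..N}. depth A x = 0 \<or> x - 1 \<in> snd ` A}"
proof -
  let ?U = "outside N A"
  note rho = rowmotion_iff[OF A]
  have U_diag: "?U x x \<longleftrightarrow> x \<in> {1..N} \<and> depth A x = 0" for x
    using depth_pos_iff[OF A, of x] by (auto simp: outside_def)
  show ?thesis
  proof (intro equalityI subsetI)
    fix x assume "x \<in> snd ` rowmotion N A"
    then obtain a where a: "?U a x" "\<not> ?U (Suc a) x" "\<not> ?U a (x - 1)" using rho by auto
    then have x: "x \<in> {1..N}" by (auto simp: outside_def)
    have "x - 1 \<in> snd ` A" if d: "depth A x \<noteq> 0"
    proof -
      have "a \<noteq> x" using U_diag[of x] a(1) d by auto
      then obtain p where "p \<in> A" "fst p \<le> a" "x - 1 \<le> snd p"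
        using a(1,3) unfolding outside_def by fastforce
      moreover from this have "\<not> x \<le> snd p" using a(1) by (auto simp: outside_def)
      ultimately have "p \<in> A" "x - 1 = snd p" by auto
      then show ?thesis by blast
    qed
    then show "x \<in> {x \<in> {1..N}. depth A x = 0 \<or> x - 1 \<in> snd ` A}" using x by blast
  next
    fix x assume x: "x \<in> {x \<in> {1..N}. depth A x = 0 \<or> x - 1 \<in> snd ` A}"
    show "x \<in> snd ` rowmotion N A"
    proof (cases "depth A x = 0")
      case True
      then have "(x, x) \<in> rowmotion N A"
        using x U_diag[of x] unfolding rho by (auto simp: outside_def)
      then show ?thesis by force
    next
      case False
      then obtain p where p: "p \<in> A" "snd p = x - 1" using x by auto
      have pN: "1 \<le> fst p" "fst p \<le> snd p" using A p by (auto simp: antichainsA_iff rootA_iff)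
      have Up: "?U (fst p) x"
      proof -
        have "\<not> (fst q \<le> fst p \<and> x \<le> snd q)" if "q \<in> A" for q
        proof
          assume q: "fst q \<le> fst p \<and> x \<le> snd q"
          then have "p = q" using A p that unfolding antichainsA_iff by (metis diff_le_self le_trans)
          then show False using q p(2) pN x by auto
        qed
        then show ?thesis using pN p x by (auto simp: outside_def)
      qed
      define a where "a = (GREATEST a. ?U a x)"
      have bd: "a \<le> x" if "?U a x" for a using that by (simp add: outside_def)
      have a: "?U a x" "fst p \<le> a"
        unfolding a_def using GreatestI_nat[of "\<lambda>a. ?U a x", OF Up bd]
          Greatest_le_nat[of "\<lambda>a. ?U a x", OF Up bd] by auto
      have "\<not> ?U (Suc a) x"
        using Greatest_le_nat[of "\<lambda>a. ?U a x", OF _ bd, of "Suc a"] by (auto simp: a_def[symmetric])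
      moreover have "\<not> ?U a (x - 1)" using p a(2) by (auto simp: outside_def)
      ultimately show ?thesis using a(1) rho by force
    qed
  qed
qed

section \<open>The fixed-point condition in terms of endpoints\<close>

lemma rowmotion_antichain: "rowmotion N A \<in> antichains (rootA N)"
  by (auto simp: rowmotion_def minimals_def antichains_def)

lemma LK_eq_iff:
  assumes A: "A \<in> antichains (rootA N)" and B: "B \<in> antichains (rootA N)"
  shows "LK N B = A \<longleftrightarrow> fst ` A = {1..N} - snd ` B \<and> snd ` A = {1..N} - fst ` B"
proof
  \<comment> \<open>Equal cardinalities ensure that \<open>zip\<close> truncates neither
    complement.\<close>
  have "card (fst ` B) = card B" "card (snd ` B) = card B"
    using inj_on_endpoints[OF B] by (simp_all add: card_image)
  then have "card ({1..N} - snd ` B) = card ({1..N} - fst ` B)"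
    using endpoints_subset[OF B] finite_antichain[OF B] by (simp add: card_Diff_subset)
  then have "fst ` LK N B = {1..N} - snd ` B" "snd ` LK N B = {1..N} - fst ` B"
    unfolding LK_def by (simp_all add: image_set_zip)
  then show "fst ` A = {1..N} - snd ` B \<and> snd ` A = {1..N} - fst ` B" if "LK N B = A"
    using that by blast
next
  assume "fst ` A = {1..N} - snd ` B \<and> snd ` A = {1..N} - fst ` B"
  then show "LK N B = A" using antichain_eq_zip[OF A] by (simp add: LK_def)
qed

text \<open>\<open>LK\<close> takes complements and exchanges left and right, which turns the
  disjunctions of \<open>fst_rowmotion\<close> and \<open>snd_rowmotion\<close> into these
  conjunctions.\<close>

lemma LK_rowmotion_eq_iff:
  assumes A: "A \<in> antichains (rootA N)"
  shows "LK N (rowmotion N A) = A \<longleftrightarrow>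
    (\<forall>x\<in>{1..N}. (x \<in> fst ` A \<longleftrightarrow> 0 < depth A x \<and> x - 1 \<notin> snd ` A) \<and>
                (x \<in> snd ` A \<longleftrightarrow> 0 < depth A x \<and> Suc x \<notin> fst ` A))"
proof -
  have eq_Diff: "I = {1..N} - {x \<in> {1..N}. P x} \<longleftrightarrow> (\<forall>x\<in>{1..N}. x \<in> I \<longleftrightarrow> \<not> P x)"
    if "I \<subseteq> {1..N}" for I P
    using that by blast
  show ?thesis
    unfolding LK_eq_iff[OF A rowmotion_antichain] fst_rowmotion[OF A] snd_rowmotion[OF A]
      eq_Diff[OF endpoints_subset(1)[OF A]] eq_Diff[OF endpoints_subset(2)[OF A]]
    by (simp add: ball_conj_distrib)
qed

section \<open>Reflection-invariant fixed points\<close>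

lemma reflect_antichain:
  assumes A: "A \<in> antichains (rootA (2 * m - 1))"
  shows "reflect m ` A \<in> antichains (rootA (2 * m - 1))"
proof -
  have b: "1 \<le> fst p \<and> fst p \<le> snd p \<and> snd p \<le> 2 * m - 1" if "p \<in> A" for p
    using A that by (auto simp: antichainsA_iff rootA_iff)
  have "reflect m p \<in> rootA (2 * m - 1)" if "p \<in> A" for p
    using b[OF that] by (auto simp: reflect_def rootA_iff)
  moreover have "reflect m p = reflect m q"
    if "p \<in> A" "q \<in> A" "fst (reflect m q) \<le> fst (reflect m p)"
      "snd (reflect m p) \<le> snd (reflect m q)" for p q
  proof -
    have "fst q \<le> fst p" "snd p \<le> snd q"
      using that(3,4) b[OF that(1)] b[OF that(2)] by (auto simp: reflect_def)
    then have "p = q" using A that(1,2) by (auto simp: antichainsA_iff)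
    then show ?thesis by simp
  qed
  ultimately show ?thesis unfolding antichainsA_iff by blast
qed

lemma image_reflect_eq_iff:
  fixes N :: nat
  assumes "X \<subseteq> {1..N}" "Y \<subseteq> {1..N}"
  shows "(\<lambda>x. Suc N - x) ` Y = X \<longleftrightarrow> (\<forall>x\<in>{1..N}. x \<in> X \<longleftrightarrow> Suc N - x \<in> Y)"
proof -
  have "x \<in> (\<lambda>x. Suc N - x) ` Y \<longleftrightarrow> Suc N - x \<in> Y" if "x \<in> {1..N}" for x
    using that assms(2) by (force simp: image_iff)
  moreover have "(\<lambda>x. Suc N - x) ` Y \<subseteq> {1..N}" using assms(2) by fastforce
  ultimately show ?thesis using assms(1) by blast
qed

text \<open>Reflection exchanges the two endpoint sets, and these determine an antichain. The
  condition for right endpoints follows from the stated one on replacing \<open>x\<close> by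
  \<open>2 * m - x\<close>.\<close>

lemma reflect_eq_iff:
  assumes A: "A \<in> antichains (rootA (2 * m - 1))"
  shows "reflect m ` A = A \<longleftrightarrow> (\<forall>x\<in>{1..2 * m - 1}. x \<in> fst ` A \<longleftrightarrow> 2 * m - x \<in> snd ` A)"
    (is "_ \<longleftrightarrow> ?R")
proof (cases "m = 0")
  case True
  then have "A = {}" using endpoints_subset(1)[OF A] by simp
  then show ?thesis by simp
next
  case False
  define N where "N = 2 * m - 1"
  have m: "2 * m = Suc N" using False by (simp add: N_def)
  note sub = endpoints_subset[OF A, folded N_def]
  have img: "fst ` reflect m ` A = (\<lambda>x. Suc N - x) ` snd ` A"
    "snd ` reflect m ` A = (\<lambda>x. Suc N - x) ` fst ` A"
    by (simp_all add: image_image reflect_def m)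
  have R: "?R \<longleftrightarrow> (\<forall>x\<in>{1..N}. x \<in> fst ` A \<longleftrightarrow> Suc N - x \<in> snd ` A)"
    by (simp add: m)
  have swap: "\<forall>x\<in>{1..N}. x \<in> snd ` A \<longleftrightarrow> Suc N - x \<in> fst ` A"
    if r: "\<forall>x\<in>{1..N}. x \<in> fst ` A \<longleftrightarrow> Suc N - x \<in> snd ` A"
  proof
    fix x assume x: "x \<in> {1..N}"
    then have "Suc N - x \<in> {1..N}" "Suc N - (Suc N - x) = x" by auto
    then show "x \<in> snd ` A \<longleftrightarrow> Suc N - x \<in> fst ` A" using r by metis
  qed
  have "reflect m ` A = A \<longleftrightarrow> fst ` reflect m ` A = fst ` A \<and> snd ` reflect m ` A = snd ` A"
    using antichain_eqI[OF reflect_antichain[OF A] A] by auto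
  also have "\<dots> \<longleftrightarrow> ?R"
    unfolding img R image_reflect_eq_iff[OF sub] image_reflect_eq_iff[OF sub(2,1)]
    using swap by blast
  finally show ?thesis .
qed

text \<open>Truncated subtraction makes a non-up step at height \<open>0\<close> flat.\<close>

primrec walk :: "nat set \<Rightarrow> nat \<Rightarrow> nat" where
  "walk S 0 = 0"
| "walk S (Suc x) = (if Suc x \<in> S then Suc (walk S x) else walk S x - 1)"

section \<open>Invariant fixed points and their first halves\<close>

definition fixed_points :: "nat \<Rightarrow> interval set set" where
  "fixed_points N = {A \<in> antichains (rootA N). LK N (rowmotion N A) = A}"

lemma fixed_pointsD:
  assumes "A \<in> fixed_points N" "x \<in> {1..N}"
  shows "x \<in> fst ` A \<longleftrightarrow> 0 < depth A x \<and> x - 1 \<notin> snd ` A"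
    "x \<in> snd ` A \<longleftrightarrow> 0 < depth A x \<and> Suc x \<notin> fst ` A"
proof -
  have A: "A \<in> antichains (rootA N)" "LK N (rowmotion N A) = A"
    using assms(1) by (simp_all add: fixed_points_def)
  note bspec[OF A(2)[unfolded LK_rowmotion_eq_iff[OF A(1)]] assms(2)]
  then show "x \<in> fst ` A \<longleftrightarrow> 0 < depth A x \<and> x - 1 \<notin> snd ` A"
    "x \<in> snd ` A \<longleftrightarrow> 0 < depth A x \<and> Suc x \<notin> fst ` A"
    by blast+
qed

text \<open>A left endpoint at \<open>Suc x\<close> excludes a right endpoint at \<open>x\<close>,
  giving a step up; otherwise positive depth forces a right endpoint at \<open>x\<close>, giving a
  step down. So the depth up to \<open>k\<close> depends only on the left endpoints up to
  \<open>k\<close>.\<close>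

lemma depth_fixed_point:
  assumes A: "A \<in> fixed_points N" and x: "x \<le> k" and k: "k \<le> N"
  shows "depth A x = walk (fst ` A \<inter> {1..k}) x"
  using x
proof (induction x)
  case 0
  show ?case using A depth_0[of A N] by (simp add: fixed_points_def)
next
  case (Suc x)
  have anti: "A \<in> antichains (rootA N)" using A by (simp add: fixed_points_def)
  note step = depth_Suc[OF anti, of x]
  have "depth A (Suc x) = (if Suc x \<in> fst ` A then Suc (depth A x) else depth A x - 1)"
  proof (cases "Suc x \<in> fst ` A")
    case True
    then have "x \<notin> snd ` A" using fixed_pointsD(1)[OF A, of "Suc x"] Suc.prems k by auto
    then show ?thesis using True step by simp
  next
    case False
    show ?thesis
    proof (cases "depth A x = 0")
      case True
      then show ?thesis using False step by simp
    next
      case pos: False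
      then have "x \<noteq> 0" using depth_0[OF anti] by metis
      then have "x \<in> snd ` A" using fixed_pointsD(2)[OF A, of x] Suc.prems k False pos by auto
      then show ?thesis using False step by simp
    qed
  qed
  then show ?case using Suc by simp
qed

text \<open>The left endpoints up to \<open>m\<close> fix the depth there, hence the right endpoints
  below \<open>m\<close>. Reflection supplies the remaining right endpoints, and then all left
  endpoints.\<close>

lemma inj_on_first_half:
  assumes "m \<ge> 1"
  shows "inj_on (\<lambda>A. fst ` A \<inter> {1..m}) {A \<in> fixed_points (2 * m - 1). reflect m ` A = A}"
proof (rule inj_onI)
  let ?N = "2 * m - 1"
  fix A B
  assume "A \<in> {A \<in> fixed_points ?N. reflect m ` A = A}"
    and "B \<in> {A \<in> fixed_points ?N. reflect m ` A = A}"
    and same: "fst ` A \<inter> {1..m} = fst ` B \<inter> {1..m}"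
  then have A: "A \<in> fixed_points ?N" "A \<in> antichains (rootA ?N)" "reflect m ` A = A"
    and B: "B \<in> fixed_points ?N" "B \<in> antichains (rootA ?N)" "reflect m ` B = B"
    by (auto simp: fixed_points_def)
  note rA = A(3)[unfolded reflect_eq_iff[OF A(2)]] and rB = B(3)[unfolded reflect_eq_iff[OF B(2)]]
  have fst_iff: "x \<in> fst ` A \<longleftrightarrow> x \<in> fst ` B" if "x \<in> {1..m}" for x
    using same that by blast
  have snd_iff: "x \<in> snd ` A \<longleftrightarrow> x \<in> snd ` B" if x: "x \<in> {1..?N}" for x
  \<comment> \<open>The criterion at \<open>x\<close> also asks about \<open>Suc x\<close>, which
    must still lie in the first half.\<close>
  proof (cases "x < m")
    case True
    have "depth A x = depth B x"
      using depth_fixed_point[OF A(1), of x m] depth_fixed_point[OF B(1), of x m] True same by simp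
    then show ?thesis
      using fixed_pointsD(2)[OF A(1) x] fixed_pointsD(2)[OF B(1) x] fst_iff[of "Suc x"] True by simp
  next
    case False
    then have y: "2 * m - x \<in> {1..?N}" "2 * m - x \<in> {1..m}" "2 * m - (2 * m - x) = x"
      using x by auto
    show ?thesis using bspec[OF rA y(1)] bspec[OF rB y(1)] fst_iff[OF y(2)] y(3) by simp
  qed
  have "fst ` A = fst ` B"
  proof -
    have "x \<in> fst ` A \<longleftrightarrow> x \<in> fst ` B" if x: "x \<in> {1..?N}" for x
    proof -
      have "2 * m - x \<in> {1..?N}" using x by auto
      then show ?thesis using bspec[OF rA x] bspec[OF rB x] snd_iff by simp
    qed
    then show ?thesis using endpoints_subset(1)[OF A(2)] endpoints_subset(1)[OF B(2)] by blast
  qed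
  moreover have "snd ` A = snd ` B"
    using snd_iff endpoints_subset(2)[OF A(2)] endpoints_subset(2)[OF B(2)] by blast
  ultimately show "A = B" using antichain_eqI[OF A(2) B(2)] by blast
qed

text \<open>The path \<open>g\<close> becomes the depth function: left endpoints are where an up
  step arrives, right endpoints where a down step departs.\<close>

lemma fixed_point_exists:
  fixes g :: "nat \<Rightarrow> nat"
  assumes ends: "g 0 = 0" "g (Suc N) = 0"
    and step: "\<And>x. x \<le> N \<Longrightarrow>
      g (Suc x) = Suc (g x) \<or> g x = Suc (g (Suc x)) \<or> g x = 0 \<and> g (Suc x) = 0"
  obtains A where "A \<in> fixed_points N"
    "fst ` A = {x \<in> {1..N}. g (x - 1) < g x}" "snd ` A = {x \<in> {1..N}. g (Suc x) < g x}"
proof -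
  define I where "I = {x \<in> {1..N}. g (x - 1) < g x}"
  define J where "J = {x \<in> {1..N}. g (Suc x) < g x}"
  have fin: "finite I" "finite J" by (simp_all add: I_def J_def)
  have sub: "I \<subseteq> {1..N}" "J \<subseteq> {1..N}" by (auto simp: I_def J_def)
  \<comment> \<open>Restricting to \<open>{1..N}\<close> loses no step: a path that is
    \<open>0\<close> at both ends neither starts with a down step nor ends with an up step.\<close>
  have balance: "g (Suc x) + of_bool (x \<in> J) = g x + of_bool (Suc x \<in> I)" if "x \<le> N" for x
    using step[OF that] ends that by (cases "x = 0"; cases "x = N") (auto simp: I_def J_def)
  have card_I: "card (I \<inter> {..x}) = card (J \<inter> {..<x}) + g x" if "x \<le> Suc N" for x
    using that
  proof (induction x)
    case 0
    have "I \<inter> {..0} = {}" by (auto simp: I_def)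
    then show ?case using ends by simp
  next
    case (Suc x)
    have "card (I \<inter> {..Suc x}) = card (I \<inter> {..x}) + of_bool (Suc x \<in> I)"
      using fin by (simp add: atMost_Suc Int_insert_right)
    moreover have "card (J \<inter> {..<Suc x}) = card (J \<inter> {..<x}) + of_bool (x \<in> J)"
      using fin by (simp add: lessThan_Suc Int_insert_right)
    ultimately show ?case using Suc balance[of x] by simp
  qed
  have all: "I \<inter> {..x} = I" "J \<inter> {..x} = J" if "N \<le> x" for x using that sub by auto
  have card_eq: "card I = card J"
    using card_I[of "Suc N"] all[of "Suc N"] all[of N] ends by (simp add: lessThan_Suc_atMost)
  have "card (J \<inter> {..x}) \<le> card (I \<inter> {..x})" for x
  proof (cases "x \<le> N")
    case True
    have "card (J \<inter> {..x}) = card (J \<inter> {..<x}) + of_bool (x \<in> J)"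
      using fin by (simp add: lessThan_Suc_atMost[symmetric] lessThan_Suc Int_insert_right)
    \<comment> \<open>A down step leaves from positive height; this yields the ballot
      condition.\<close>
    moreover have "of_bool (x \<in> J) \<le> g x" by (auto simp: J_def)
    ultimately show ?thesis using card_I[of x] True by simp
  next
    case False
    then show ?thesis using all[of x] card_eq by simp
  qed
  then obtain A where A: "A \<in> antichains (rootA N)" "fst ` A = I" "snd ` A = J"
    using antichain_exists[OF sub card_eq] by blast
  \<comment> \<open>Both functions vanish at \<open>0\<close> and satisfy the same
    recurrence.\<close>
  have depth: "depth A x = g x" if "x \<le> Suc N" for x
    using that
  proof (induction x)
    case 0
    then show ?case using depth_0[OF A(1)] ends by simp
  next
    case (Suc x)
    then show ?case using depth_Suc[OF A(1), of x] balance[of x] A(2,3) by simp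
  qed
  have "LK N (rowmotion N A) = A"
    unfolding LK_rowmotion_eq_iff[OF A(1)] A(2,3)
  proof (intro ballI conjI)
    fix x assume x: "x \<in> {1..N}"
    then obtain y where y: "x = Suc y" by (cases x) auto
    \<comment> \<open>At positive height neither adjacent step is flat, so not being a down step
      means being an up step, and conversely.\<close>
    show "x \<in> I \<longleftrightarrow> 0 < depth A x \<and> x - 1 \<notin> J"
      using x step[of y] ends depth[of x] by (cases "y = 0") (auto simp: I_def J_def y)
    show "x \<in> J \<longleftrightarrow> 0 < depth A x \<and> Suc x \<notin> I"
      using x step[of x] ends depth[of x] by (cases "x = N") (auto simp: I_def J_def)
  qed
  with A that show thesis by (simp add: fixed_points_def I_def J_def)
qed

text \<open>The walk of \<open>S\<close> up to \<open>m\<close>, followed by its mirror image, meets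
  the conditions of \<open>fixed_point_exists\<close>.\<close>

lemma first_half_surj:
  assumes m: "m \<ge> 1" and S: "S \<subseteq> {1..m}"
  obtains A where "A \<in> fixed_points (2 * m - 1)" "reflect m ` A = A" "fst ` A \<inter> {1..m} = S"
proof -
  define g where "g x = walk S (min x (2 * m - x))" for x
  have walk_step: "walk S (Suc x) = Suc (walk S x) \<or> walk S x = Suc (walk S (Suc x))
      \<or> walk S x = 0 \<and> walk S (Suc x) = 0" for x
    by auto
  have low: "g x = walk S x" if "x \<le> m" for x
  proof -
    have "min x (2 * m - x) = x" using that by linarith
    then show ?thesis by (simp add: g_def)
  qed
  have sym: "g (2 * m - x) = g x" if "x \<le> 2 * m" for x
    using that by (simp add: g_def min.commute)
  have step: "g (Suc x) = Suc (g x) \<or> g x = Suc (g (Suc x)) \<or> g x = 0 \<and> g (Suc x) = 0"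
    if "x \<le> 2 * m - 1" for x
  proof (cases "x < m")
    case True
    then show ?thesis using walk_step[of x] low[of x] low[of "Suc x"] by simp
  next
    case False
    \<comment> \<open>The step from \<open>x\<close> to \<open>Suc x\<close> is the step from
      \<open>y\<close> to \<open>Suc y\<close> reversed, and the allowed steps are closed under
      reversal.\<close>
    define y where "y = 2 * m - Suc x"
    have "y < m" "2 * m - Suc y = x" "2 * m - y = Suc x" using False that m by (auto simp: y_def)
    then have "g x = walk S (Suc y)" "g (Suc x) = walk S y"
      using sym[of y] sym[of "Suc y"] low[of y] low[of "Suc y"] by simp_all
    then show ?thesis using walk_step[of y] by auto
  qed
  have "g 0 = 0" "g (Suc (2 * m - 1)) = 0" using m by (simp_all add: g_def)
  then obtain A where A: "A \<in> fixed_points (2 * m - 1)"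
    "fst ` A = {x \<in> {1..2 * m - 1}. g (x - 1) < g x}"
    "snd ` A = {x \<in> {1..2 * m - 1}. g (Suc x) < g x}"
    by (rule fixed_point_exists[of g "2 * m - 1", OF _ _ step])
  have anti: "A \<in> antichains (rootA (2 * m - 1))" using A(1) by (simp add: fixed_points_def)
  have "reflect m ` A = A"
    unfolding reflect_eq_iff[OF anti] A(2,3)
  proof
    fix x assume x: "x \<in> {1..2 * m - 1}"
    then have "2 * m - (x - 1) = Suc (2 * m - x)" by auto
    then have "g (Suc (2 * m - x)) = g (x - 1)" "g (2 * m - x) = g x"
      using sym[of "x - 1"] sym[of x] x by auto
    moreover have "2 * m - x \<in> {1..2 * m - 1}" using x by auto
    ultimately show "x \<in> {x \<in> {1..2 * m - 1}. g (x - 1) < g x} \<longleftrightarrow>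
        2 * m - x \<in> {x \<in> {1..2 * m - 1}. g (Suc x) < g x}"
      using x by simp
  qed
  moreover have "fst ` A \<inter> {1..m} = S"
  proof -
    have "g (x - 1) < g x \<longleftrightarrow> x \<in> S" if "x \<in> {1..m}" for x
      using that low[of x] low[of "x - 1"] by (cases x) auto
    then show ?thesis using S m unfolding A(2) by fastforce
  qed
  ultimately show thesis using A(1) that by blast
qed

theorem proposition5p9:
  fixes m :: nat
  assumes "m \<ge> 1"
  shows "card {A \<in> antichains (rootB m).
           LK (2 * m - 1) (rowmotion (2 * m - 1) (hat m A)) = hat m A} = 2 ^ m"
proof -
  let ?N = "2 * m - 1"
  let ?B = "{A \<in> antichains (rootB m). LK ?N (rowmotion ?N (hat m A)) = hat m A}"
  let ?F = "{A \<in> fixed_points ?N. reflect m ` A = A}"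
  have "bij_betw (hat m) ?B (hat m ` ?B)"
    using bij_betw_hat[of m] by (rule bij_betw_subset) auto
  moreover have "hat m ` ?B = ?F"
  proof -
    have "hat m ` ?B = {A \<in> hat m ` antichains (rootB m). LK ?N (rowmotion ?N A) = A}"
      by blast
    also have "\<dots> = ?F"
      unfolding bij_betw_imp_surj_on[OF bij_betw_hat[of m]] fixed_points_def by blast
    finally show ?thesis .
  qed
  ultimately have "bij_betw (hat m) ?B ?F" by simp
  moreover have "bij_betw (\<lambda>A. fst ` A \<inter> {1..m}) ?F (Pow {1..m})"
    unfolding bij_betw_def
  proof (intro conjI inj_on_first_half[OF assms] equalityI subsetI)
    fix S assume "S \<in> Pow {1..m}"
    then have "S \<subseteq> {1..m}" by simp
    then obtain A where "A \<in> fixed_points ?N" "reflect m ` A = A" and half: "fst ` A \<inter> {1..m} = S"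
      by (rule first_half_surj[OF assms])
    then have "A \<in> ?F" by simp
    then show "S \<in> (\<lambda>A. fst ` A \<inter> {1..m}) ` ?F" using half by blast
  qed auto
  ultimately have "card ?B = card (Pow {1..m})"
    by (meson bij_betw_same_card bij_betw_trans)
  then show ?thesis by (simp add: card_Pow)
qed

end
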